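(* Let $\mathcal T_n$ be a uniform random recursive tree with $n$ nodes. Define functions $p_\ell:[0,\infty)\to\mathbb R$, $\ell\ge0$, recursively by $p_0(t)=1$ and, for $\ell\ge1$, $$p_\ell(t)=e^{-t}\left(\exp\left(\int_0^t p_{\ell-1}(s)\,\mathrm ds\right)-1\right)$$ (so that $p_1(t)=1-e^{-t}$), and set $$p_{*,\ell}=\int_0^\infty p_\ell(t)e^{-t}\,\mathrm dt .$$ For each fixed integer $\ell\ge1$, let $p_{\mathsf p,\ell}(\mathcal T_n)$ be the proportion of nodes of $\mathcal T_n$ that are $\ell$-protected. Then, as $n\to\infty$: (i) the probability $\mathbb E\,p_{\mathsf p,\ell}(\mathcal T_n)$ that a uniformly random node in the random tree $\mathcal T_n$ is $\ell$-protected tends to $p_{*,\ell}$; (ii) $p_{\mathsf p,\ell}(\mathcal T_n)$ converges in probability to $p_{*,\ell}$. In particular, for $\ell=2$ (protected nodes), $p_2(t)=\exp(e^{-t}-1)-e^{-t}$ and the limit is $p_{*,2}=\frac12-e^{-1}$.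
   Context: A uniform random recursive tree $\mathcal T_n$ of order $n$ is a random rooted tree with $n$ nodes labelled $1,\dots,n$: the root is labelled $1$, and for $2\le i\le n$ the node labelled $i$ chooses its parent uniformly at random in $\{1,\dots,i-1\}$, independently of the other choices. A leaf is a node with no children. For an integer $\ell\ge1$, a node is $\ell$-protected if it has distance at least $\ell$ to every leaf that is a descendant of it (a node counts as a descendant of itself, at distance $0$); 2-protected nodes are called protected: they are the non-leaf nodes none of whose children is a leaf. *)

theory Defs
  imports "HOL-Probability.Probability"
begin

text \<open>
  A recursive tree of order \<open>n\<close> is represented by its parent function
  \<open>f\<close>: for \<open>2 \<le> i \<le> n\<close> the parent of node \<open>i\<close> is
  \<open>f i \<in> {1..<i}\<close>, and \<open>f\<close> is \<open>0\<close> elsewhere. The index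
  set is empty for \<open>n \<le> 1\<close>.
\<close>

definition random_recursive_tree :: "nat \<Rightarrow> (nat \<Rightarrow> nat) pmf" where
  "random_recursive_tree n = Pi_pmf {2..n} 0 (\<lambda>i. pmf_of_set {1..<i})"

definition child_rel :: "nat \<Rightarrow> (nat \<Rightarrow> nat) \<Rightarrow> (nat \<times> nat) set" where
  "child_rel n f = {(f i, i) | i. i \<in> {2..n}}"

definition is_leaf :: "nat \<Rightarrow> (nat \<Rightarrow> nat) \<Rightarrow> nat \<Rightarrow> bool" where
  "is_leaf n f v \<longleftrightarrow> v \<in> {1..n} \<and> (\<nexists>w. (v, w) \<in> child_rel n f)"

definition descendant :: "nat \<Rightarrow> (nat \<Rightarrow> nat) \<Rightarrow> nat \<Rightarrow> nat \<Rightarrow> bool" where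
  "descendant n f v w \<longleftrightarrow> (v, w) \<in> (child_rel n f)\<^sup>*"

text \<open>
  Graph distance: the length of a shortest walk in the underlying undirected tree.
\<close>

definition tree_dist :: "nat \<Rightarrow> (nat \<Rightarrow> nat) \<Rightarrow> nat \<Rightarrow> nat \<Rightarrow> nat" where
  "tree_dist n f v w = (LEAST k. (v, w) \<in> (child_rel n f \<union> (child_rel n f)\<inverse>) ^^ k)"

definition l_protected :: "nat \<Rightarrow> nat \<Rightarrow> (nat \<Rightarrow> nat) \<Rightarrow> nat \<Rightarrow> bool" where
  "l_protected l n f v \<longleftrightarrow>
     (\<forall>w. is_leaf n f w \<and> descendant n f v w \<longrightarrow> l \<le> tree_dist n f v w)"

definition protected_proportion :: "nat \<Rightarrow> nat \<Rightarrow> (nat \<Rightarrow> nat) \<Rightarrow> real" where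
  "protected_proportion l n f = real (card {v \<in> {1..n}. l_protected l n f v}) / real n"

definition random_tree_and_node :: "nat \<Rightarrow> ((nat \<Rightarrow> nat) \<times> nat) pmf" where
  "random_tree_and_node n = pair_pmf (random_recursive_tree n) (pmf_of_set {1..n})"

text \<open>
  Convergence in probability to a constant; the variables \<open>X n\<close> may live on
  different probability spaces.
\<close>

definition tendsto_in_prob :: "(nat \<Rightarrow> 'a pmf) \<Rightarrow> (nat \<Rightarrow> 'a \<Rightarrow> real) \<Rightarrow> real \<Rightarrow> bool" where
  "tendsto_in_prob M X c \<longleftrightarrow>
     (\<forall>\<epsilon>>0. (\<lambda>n. measure_pmf.prob (M n) {x. \<bar>X n x - c\<bar> > \<epsilon>}) \<longlonglongrightarrow> 0)"

primrec p_fun :: "nat \<Rightarrow> real \<Rightarrow> real" where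
  "p_fun 0 = (\<lambda>t. 1)"
| "p_fun (Suc l) = (\<lambda>t. exp (- t) * (exp (integral {0..t} (p_fun l)) - 1))"

definition p_star :: "nat \<Rightarrow> real" where
  "p_star l = integral {0..} (\<lambda>t. p_fun l t * exp (- t))"

end

theory Submission imports Defs begin

text \<open>
  Splitting off the subtree of node 2, whose size is uniform on \<open>{1, \<dots>, n - 1}\<close>, gives recursions for the
  probability \<open>q\<^sub>l k\<close> that the root of a tree with \<open>k\<close> nodes is \<open>l\<close>-protected, and for the expected number of
  \<open>l\<close>-protected non-root nodes. The latter is solved exactly by
  \<open>n (\<Sum>k<n. q\<^sub>l k / (k (k + 1)))\<close>. The generating function of \<open>k \<mapsto> q\<^sub>l k\<close> satisfies the recursion that
  defines \<open>p\<^sub>l\<close> after the substitution \<open>x = 1 - exp (- t)\<close>, and \<open>1 / (k (k + 1))\<close> is a beta integral, so the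
  sum converges to \<open>p\<^sub>*\<^sub>,\<^sub>l\<close>.

  Changing the parent of one node changes the \<open>l\<close>-protection of at most \<open>2 l\<close> nodes. As the parents are
  independent, the number of \<open>l\<close>-protected nodes has variance at most \<open>4 l\<^sup>2 n\<close>, and Chebyshev's inequality
  turns convergence of the mean into convergence in probability.
\<close>

section \<open>Protected nodes of recursive trees\<close>

text \<open>A rooted tree is either a single node or \<open>Attach a b\<close>, the tree \<open>b\<close> together with
  one more child subtree \<open>a\<close> of its root, to the left of the others. In \<open>tree_of f n\<close>, which has \<open>n + 1\<close> nodes,
  children are in increasing order, so that the outermost \<open>Attach\<close> splits off the subtree of node 2.\<close>
datatype 'a rtree = Node 'a | Attach "'a rtree" "'a rtree"

primrec root_label :: "'a rtree \<Rightarrow> 'a" where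
  "root_label (Node v) = v"
| "root_label (Attach a b) = root_label b"

primrec edges :: "'a rtree \<Rightarrow> ('a \<times> 'a) set" where
  "edges (Node v) = {}"
| "edges (Attach a b) = insert (root_label b, root_label a) (edges a \<union> edges b)"

primrec distinct_labels :: "'a rtree \<Rightarrow> bool" where
  "distinct_labels (Node v) \<longleftrightarrow> True"
| "distinct_labels (Attach a b) \<longleftrightarrow>
     distinct_labels a \<and> distinct_labels b \<and> set_rtree a \<inter> set_rtree b = {}"

text \<open>The recursion descends to the innermost \<open>Node\<close>, so the new child comes
  after all earlier children of \<open>v\<close>. Visiting both branches is harmless: with distinct
  labels only one of them contains \<open>v\<close>.\<close>

primrec add_child :: "'a \<Rightarrow> 'a \<Rightarrow> 'a rtree \<Rightarrow> 'a rtree" where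
  "add_child i v (Node w) = (if w = v then Attach (Node i) (Node w) else Node w)"
| "add_child i v (Attach a b) = Attach (add_child i v a) (add_child i v b)"

primrec tree_of :: "(nat \<Rightarrow> nat) \<Rightarrow> nat \<Rightarrow> nat rtree" where
  "tree_of f 0 = Node 1"
| "tree_of f (Suc n) = add_child (n + 2) (f (n + 2)) (tree_of f n)"

lemma root_in_set: "root_label t \<in> set_rtree t"
  by (induction t) auto

lemma finite_set_rtree: "finite (set_rtree t)"
  by (induction t) auto

lemma root_add_child [simp]: "root_label (add_child i v t) = root_label t"
  by (induction t) auto

lemma add_child_absent: "v \<notin> set_rtree t \<Longrightarrow> add_child i v t = t"
  by (induction t) auto

lemma set_add_child:
  "set_rtree (add_child i v t) = (if v \<in> set_rtree t then insert i (set_rtree t) else set_rtree t)"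
  by (induction t) auto

lemma distinct_add_child:
  "distinct_labels t \<Longrightarrow> i \<notin> set_rtree t \<Longrightarrow> distinct_labels (add_child i v t)"
  by (induction t) (auto simp: set_add_child)

lemma edges_add_child:
  "v \<in> set_rtree t \<Longrightarrow> distinct_labels t \<Longrightarrow> edges (add_child i v t) = insert (v, i) (edges t)"
proof (induction t)
  case (Attach a b)
  then consider "v \<in> set_rtree a" "v \<notin> set_rtree b" | "v \<notin> set_rtree a" "v \<in> set_rtree b"
    by auto
  then show ?case
    using Attach by cases (simp_all add: add_child_absent insert_commute)
qed auto

lemma edges_subset: "distinct_labels t \<Longrightarrow> edges t \<subseteq> set_rtree t \<times> (set_rtree t - {root_label t})"
proof (induction t)
  case (Attach a b)
  then show ?case using root_in_set[of a] root_in_set[of b] by fastforce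
qed auto

lemma child_rel_Suc: "child_rel (Suc (Suc n)) f = insert (f (n + 2), n + 2) (child_rel (Suc n) f)"
proof -
  have "{2..Suc (Suc n)} = insert (n + 2) {2..Suc n}" by auto
  then show ?thesis by (auto simp: child_rel_def)
qed

lemma tree_of_correct:
  assumes "\<And>i. i \<in> {2..Suc n} \<Longrightarrow> f i \<in> {1..<i}"
  shows "set_rtree (tree_of f n) = {1..Suc n} \<and> distinct_labels (tree_of f n) \<and>
    edges (tree_of f n) = child_rel (Suc n) f"
  using assms
proof (induction n)
  case 0
  then show ?case by (auto simp: child_rel_def)
next
  case (Suc n)
  have "f (n + 2) \<in> {1..Suc n}" using Suc.prems[of "n + 2"] by auto
  then show ?case
    using Suc by (auto simp: set_add_child distinct_add_child edges_add_child child_rel_Suc)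
qed

lemma tree_of_cong:
  "(\<And>i. i \<in> {2..Suc n} \<Longrightarrow> f i = g i) \<Longrightarrow> tree_of f n = tree_of g n"
  by (induction n) auto

text \<open>Trades leaf distances for a recursion on the level, justified by
  \<open>prot_iff_leaf_distance\<close>. The existence clause makes leaves fail at every positive
  level.\<close>

primrec prot :: "nat \<Rightarrow> ('a \<times> 'a) set \<Rightarrow> 'a \<Rightarrow> bool" where
  "prot 0 R v \<longleftrightarrow> True"
| "prot (Suc l) R v \<longleftrightarrow> (\<exists>w. (v, w) \<in> R) \<and> (\<forall>w. (v, w) \<in> R \<longrightarrow> prot l R w)"

text \<open>In \<open>Attach a b\<close> the part \<open>b\<close> may be a single node although its
  root now has the child \<open>a\<close>. The condition on the remaining children must then hold
  vacuously, which calls for the second predicate.\<close>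

fun root_prot :: "nat \<Rightarrow> 'a rtree \<Rightarrow> bool" and children_prot :: "nat \<Rightarrow> 'a rtree \<Rightarrow> bool" where
  "root_prot 0 t \<longleftrightarrow> True"
| "root_prot (Suc l) (Node v) \<longleftrightarrow> False"
| "root_prot (Suc l) (Attach a b) \<longleftrightarrow> root_prot l a \<and> children_prot l b"
| "children_prot l (Node v) \<longleftrightarrow> True"
| "children_prot l (Attach a b) \<longleftrightarrow> root_prot l a \<and> children_prot l b"

text \<open>Attaching \<open>a\<close> can change the protection of the root of \<open>b\<close> but
  of no other node, so only the count without the root is additive.\<close>

primrec nonroot_prot_count :: "nat \<Rightarrow> 'a rtree \<Rightarrow> nat" where
  "nonroot_prot_count l (Node v) = 0"
| "nonroot_prot_count l (Attach a b) =
     of_bool (root_prot l a) + nonroot_prot_count l a + nonroot_prot_count l b"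

text \<open>Unfolding protection from a node of \<open>S\<close> stays in \<open>S\<close>: edges
  out of \<open>S\<close> agree, and all edges of \<open>R'\<close> end in \<open>S\<close>.\<close>

lemma prot_cong_closed:
  assumes "\<And>v w. v \<in> S \<Longrightarrow> (v, w) \<in> R \<longleftrightarrow> (v, w) \<in> R'" "R' \<subseteq> UNIV \<times> S" "v \<in> S"
  shows "prot l R v \<longleftrightarrow> prot l R' v"
  using assms(3)
proof (induction l arbitrary: v)
  case (Suc l)
  have "\<And>w. (v, w) \<in> R' \<Longrightarrow> prot l R w = prot l R' w"
    using Suc.IH assms(2) by auto
  then show ?case using assms(1)[OF Suc.prems] by auto
qed simp

context
  fixes a b :: "'a rtree"
  assumes distinct: "distinct_labels (Attach a b)"
begin

lemma prot_Attach_left: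
  assumes "v \<in> set_rtree a"
  shows "prot l (edges (Attach a b)) v \<longleftrightarrow> prot l (edges a) v"
proof (rule prot_cong_closed[where S = "set_rtree a"])
  show "(v, w) \<in> edges (Attach a b) \<longleftrightarrow> (v, w) \<in> edges a" if "v \<in> set_rtree a" for v w
    using that distinct edges_subset[of b] root_in_set[of b] by auto
  show "edges a \<subseteq> UNIV \<times> set_rtree a" using distinct edges_subset[of a] by auto
qed fact

lemma prot_Attach_right:
  assumes "v \<in> set_rtree b - {root_label b}"
  shows "prot l (edges (Attach a b)) v \<longleftrightarrow> prot l (edges b) v"
proof (rule prot_cong_closed[where S = "set_rtree b - {root_label b}"])
  show "(v, w) \<in> edges (Attach a b) \<longleftrightarrow> (v, w) \<in> edges b" if "v \<in> set_rtree b - {root_label b}" for v w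
    using that distinct edges_subset[of a] by auto
  show "edges b \<subseteq> UNIV \<times> (set_rtree b - {root_label b})" using distinct edges_subset[of b] by auto
qed fact

lemma children_Attach_root:
  "(root_label b, w) \<in> edges (Attach a b) \<longleftrightarrow> w = root_label a \<or> (root_label b, w) \<in> edges b"
  using distinct edges_subset[of a] root_in_set[of b] by auto

end

text \<open>Both claims go through one induction along the mutual recursion. The children of the
  root of \<open>b\<close> are non-root nodes of \<open>b\<close>, so attaching \<open>a\<close>
  leaves their protection unchanged.\<close>

lemma prot_root_edges:
  "distinct_labels t \<Longrightarrow> prot l (edges t) (root_label t) \<longleftrightarrow> root_prot l t"
  "distinct_labels t \<Longrightarrow> (\<forall>w. (root_label t, w) \<in> edges t \<longrightarrow> prot l (edges t) w) \<longleftrightarrow> children_prot l t"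
proof (induction l t rule: root_prot_children_prot.induct)
  case (5 l a b)
  have "prot l (edges (Attach a b)) w \<longleftrightarrow> prot l (edges b) w" if "(root_label b, w) \<in> edges b" for w
    using that edges_subset[of b] 5 by (intro prot_Attach_right) auto
  then show ?case
    using 5 prot_Attach_left[of a b "root_label a" l] root_in_set[of a]
      children_Attach_root[of a b] by auto
next
  case (3 l a b)
  have "prot l (edges (Attach a b)) w \<longleftrightarrow> prot l (edges b) w" if "(root_label b, w) \<in> edges b" for w
    using that edges_subset[of b] 3 by (intro prot_Attach_right) auto
  then show ?case
    using 3 prot_Attach_left[of a b "root_label a" l] root_in_set[of a]
      children_Attach_root[of a b] by auto
qed auto

lemma nonroot_prot_count_edges:
  "distinct_labels t \<Longrightarrow>
   card {v \<in> set_rtree t - {root_label t}. prot l (edges t) v} = nonroot_prot_count l t"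
proof (induction t)
  case (Node v)
  then show ?case by (simp add: Collect_conv_if)
next
  case (Attach a b)
  let ?P = "\<lambda>t. {v \<in> set_rtree t - {root_label t}. prot l (edges t) v}"
  \<comment> \<open>The root of \<open>a\<close> is no longer a root in the whole tree, so it enters
    the count separately.\<close>
  let ?r = "{v. v = root_label a \<and> root_prot l a}"
  have "?P (Attach a b) = (?r \<union> ?P a) \<union> ?P b"
    using Attach.prems prot_Attach_left[OF Attach.prems] prot_Attach_right[OF Attach.prems]
      prot_root_edges(1)[of a l] root_in_set[of a] root_in_set[of b] by auto
  moreover have "card ((?r \<union> ?P a) \<union> ?P b) = card (?r \<union> ?P a) + card (?P b)"
    using Attach.prems root_in_set[of a]
    by (intro card_Un_disjoint) (auto simp: finite_set_rtree)
  moreover have "card (?r \<union> ?P a) = card ?r + card (?P a)"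
    by (intro card_Un_disjoint) (auto simp: finite_set_rtree)
  ultimately show ?case using Attach by (simp add: Collect_conv_if)
qed

lemma prot_count_edges:
  assumes "distinct_labels t"
  shows "card {v \<in> set_rtree t. prot l (edges t) v} = of_bool (root_prot l t) + nonroot_prot_count l t"
proof -
  have "{v \<in> set_rtree t. prot l (edges t) v} =
    {v. v = root_label t \<and> root_prot l t} \<union> {v \<in> set_rtree t - {root_label t}. prot l (edges t) v}"
    using prot_root_edges(1)[OF assms] root_in_set[of t] by auto
  moreover have "card \<dots> = card {v. v = root_label t \<and> root_prot l t} + nonroot_prot_count l t"
    using nonroot_prot_count_edges[OF assms]
    by (subst card_Un_disjoint) (auto simp: finite_set_rtree)
  ultimately show ?thesis by (simp add: Collect_conv_if)
qed

lemma root_prot_map [simp]: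
  "root_prot l (map_rtree h t) = root_prot l t"
  "children_prot l (map_rtree h t) = children_prot l t"
  by (induction l t rule: root_prot_children_prot.induct) auto

lemma nonroot_prot_count_map [simp]: "nonroot_prot_count l (map_rtree h t) = nonroot_prot_count l t"
  by (induction t) auto

section \<open>Averaging over random tree shapes\<close>

text \<open>\<open>growth_sum \<phi> t\<close> sums \<open>\<phi>\<close> over the trees obtained from \<open>t\<close> by adding a last child to one of its
  nodes, so \<open>shape_mean n \<phi>\<close> is the mean of \<open>\<phi>\<close> over random recursive trees with \<open>n + 1\<close> nodes.\<close>
primrec growth_sum :: "(unit rtree \<Rightarrow> real) \<Rightarrow> unit rtree \<Rightarrow> real" where
  "growth_sum \<phi> (Node u) = \<phi> (Attach (Node ()) (Node ()))"
| "growth_sum \<phi> (Attach a b) =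
     growth_sum (\<lambda>a'. \<phi> (Attach a' b)) a + growth_sum (\<lambda>b'. \<phi> (Attach a b')) b"

primrec shape_mean :: "nat \<Rightarrow> (unit rtree \<Rightarrow> real) \<Rightarrow> real" where
  "shape_mean 0 \<phi> = \<phi> (Node ())"
| "shape_mean (Suc n) \<phi> = shape_mean n (growth_sum \<phi>) / real (Suc n)"

lemma growth_sum_add: "growth_sum (\<lambda>t. \<phi> t + \<psi> t) = (\<lambda>t. growth_sum \<phi> t + growth_sum \<psi> t)"
proof
  show "growth_sum (\<lambda>t. \<phi> t + \<psi> t) t = growth_sum \<phi> t + growth_sum \<psi> t" for t
    by (induction t arbitrary: \<phi> \<psi>) (auto simp: algebra_simps)
qed

lemma growth_sum_cmult: "growth_sum (\<lambda>t. c * \<phi> t) = (\<lambda>t. c * growth_sum \<phi> t)"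
proof
  show "growth_sum (\<lambda>t. c * \<phi> t) t = c * growth_sum \<phi> t" for t
    by (induction t arbitrary: \<phi>) (auto simp: algebra_simps)
qed

lemma growth_sum_mono: "(\<And>t. \<phi> t \<le> \<psi> t) \<Longrightarrow> growth_sum \<phi> t \<le> growth_sum \<psi> t"
  by (induction t arbitrary: \<phi> \<psi>) (auto intro!: add_mono)

lemma shape_mean_add: "shape_mean n (\<lambda>t. \<phi> t + \<psi> t) = shape_mean n \<phi> + shape_mean n \<psi>"
  by (induction n arbitrary: \<phi> \<psi>) (auto simp: growth_sum_add add_divide_distrib)

lemma shape_mean_cmult: "shape_mean n (\<lambda>t. c * \<phi> t) = c * shape_mean n \<phi>"
  by (induction n arbitrary: \<phi>) (auto simp: growth_sum_cmult)

lemma shape_mean_mono: "(\<And>t. \<phi> t \<le> \<psi> t) \<Longrightarrow> shape_mean n \<phi> \<le> shape_mean n \<psi>"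
proof (induction n arbitrary: \<phi> \<psi>)
  case (Suc n)
  have "shape_mean n (growth_sum \<phi>) \<le> shape_mean n (growth_sum \<psi>)"
    by (intro Suc.IH growth_sum_mono Suc.prems)
  then show ?case by (simp add: divide_right_mono)
qed simp

text \<open>Growing \<open>t\<close> is a finite sum, and averaging is linear.\<close>

lemma shape_mean_growth_sum_swap:
  "shape_mean m (\<lambda>b. growth_sum (\<lambda>a. \<psi> a b) t) = growth_sum (\<lambda>a. shape_mean m (\<psi> a)) t"
  by (induction t arbitrary: \<psi>) (auto simp: shape_mean_add)

lemma shape_mean_Suc_mult: "real (Suc n) * shape_mean (Suc n) \<phi> = shape_mean n (growth_sum \<phi>)"
  by simp

text \<open>The subtree hanging off the second node has uniform size, and it is independent of the rest
  given its size. The induction is the one for the Polya urn started with one ball of either colour.\<close>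
lemma shape_mean_split:
  "real (Suc n) * shape_mean (Suc n) \<phi> =
    (\<Sum>k\<le>n. shape_mean k (\<lambda>a. shape_mean (n - k) (\<lambda>b. \<phi> (Attach a b))))"
proof (induction n arbitrary: \<phi>)
  case (Suc n)
  define h where "h k m = shape_mean k (\<lambda>a. shape_mean m (\<lambda>b. \<phi> (Attach a b)))" for k m
  have left: "shape_mean k (\<lambda>a. shape_mean m (\<lambda>b. growth_sum (\<lambda>a'. \<phi> (Attach a' b)) a)) =
    real (Suc k) * h (Suc k) m" for k m
    unfolding h_def shape_mean_Suc_mult shape_mean_growth_sum_swap ..
  have right: "shape_mean k (\<lambda>a. shape_mean m (growth_sum (\<lambda>b. \<phi> (Attach a b)))) =
    real (Suc m) * h k (Suc m)" for k m
    unfolding h_def shape_mean_Suc_mult[symmetric] shape_mean_cmult ..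
  have "real (Suc n) * (real (Suc (Suc n)) * shape_mean (Suc (Suc n)) \<phi>) =
    real (Suc n) * shape_mean (Suc n) (growth_sum \<phi>)"
    unfolding shape_mean_Suc_mult ..
  also have "\<dots> = (\<Sum>k\<le>n. real (Suc k) * h (Suc k) (n - k) + real (Suc (n - k)) * h k (Suc (n - k)))"
    unfolding Suc.IH by (simp only: growth_sum.simps shape_mean_add left right)
  also have "\<dots> = (\<Sum>k\<le>n. real (Suc k) * h (Suc k) (n - k)) + (\<Sum>k\<le>n. real (Suc n - k) * h k (Suc n - k))"
    by (simp add: sum.distrib Suc_diff_le)
  also have "(\<Sum>k\<le>n. real (Suc k) * h (Suc k) (n - k)) = (\<Sum>k\<le>Suc n. real k * h k (Suc n - k))"
    by (subst sum.atMost_Suc_shift) simp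
  also have "(\<Sum>k\<le>n. real (Suc n - k) * h k (Suc n - k)) = (\<Sum>k\<le>Suc n. real (Suc n - k) * h k (Suc n - k))"
    by simp
  also have "(\<Sum>k\<le>Suc n. real k * h k (Suc n - k)) + \<dots> = real (Suc n) * (\<Sum>k\<le>Suc n. h k (Suc n - k))"
    unfolding sum.distrib[symmetric] sum_distrib_left
    by (intro sum.cong) (auto simp: algebra_simps of_nat_diff)
  finally show ?case by (simp add: h_def)
qed simp

text \<open>Links growth of unlabelled shapes to labelled trees. Distinct labels ensure that
  \<open>add_child\<close> alters only the branch containing \<open>v\<close>.\<close>

lemma growth_sum_add_child:
  "distinct_labels t \<Longrightarrow>
   growth_sum \<phi> (map_rtree (\<lambda>_. ()) t) = (\<Sum>v\<in>set_rtree t. \<phi> (map_rtree (\<lambda>_. ()) (add_child i v t)))"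
proof (induction t arbitrary: \<phi>)
  case (Attach a b)
  let ?s = "map_rtree (\<lambda>_. ())"
  have "(\<Sum>v\<in>set_rtree (Attach a b). \<phi> (?s (add_child i v (Attach a b)))) =
    (\<Sum>v\<in>set_rtree a. \<phi> (?s (add_child i v (Attach a b)))) +
    (\<Sum>v\<in>set_rtree b. \<phi> (?s (add_child i v (Attach a b))))"
    using Attach.prems by (simp add: sum.union_disjoint finite_set_rtree)
  also have "(\<Sum>v\<in>set_rtree a. \<phi> (?s (add_child i v (Attach a b)))) =
    (\<Sum>v\<in>set_rtree a. \<phi> (Attach (?s (add_child i v a)) (?s b)))"
    using Attach.prems by (intro sum.cong refl) (simp add: add_child_absent disjoint_iff)
  also have "(\<Sum>v\<in>set_rtree b. \<phi> (?s (add_child i v (Attach a b)))) =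
    (\<Sum>v\<in>set_rtree b. \<phi> (Attach (?s a) (?s (add_child i v b))))"
  proof (intro sum.cong refl)
    fix v assume "v \<in> set_rtree b"
    then have "v \<notin> set_rtree a" using Attach.prems by auto
    then show "\<phi> (?s (add_child i v (Attach a b))) = \<phi> (Attach (?s a) (?s (add_child i v b)))"
      by (simp add: add_child_absent)
  qed
  finally show ?case using Attach by simp
qed simp

text \<open>As in \<open>shape_mean\<close>, index \<open>n\<close> refers to trees with
  \<open>n + 1\<close> nodes, here and in the next two definitions.\<close>

definition prot_prob :: "nat \<Rightarrow> nat \<Rightarrow> real" where
  "prot_prob l n = shape_mean n (\<lambda>t. of_bool (root_prot l t))"

definition children_prob :: "nat \<Rightarrow> nat \<Rightarrow> real" where
  "children_prob l n = shape_mean n (\<lambda>t. of_bool (children_prot l t))"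

definition nonroot_mean :: "nat \<Rightarrow> nat \<Rightarrow> real" where
  "nonroot_mean l n = shape_mean n (\<lambda>t. real (nonroot_prot_count l t))"

text \<open>Induction along \<open>growth_sum\<close> would not stay with constants, as it
  multiplies them by the number of nodes. The splitting identity does, and reduces to smaller
  trees.\<close>

lemma shape_mean_const [simp]: "shape_mean n (\<lambda>_. c) = c"
proof (induction n arbitrary: c rule: less_induct)
  case (less n)
  show ?case
  proof (cases n)
    case (Suc m)
    have "real n * shape_mean n (\<lambda>_. c) = (\<Sum>k\<le>m. shape_mean k (\<lambda>_. shape_mean (m - k) (\<lambda>_. c)))"
      unfolding Suc shape_mean_split ..
    also have "\<dots> = (\<Sum>k\<le>m. c)"
      by (intro sum.cong refl) (simp add: less Suc)
    finally show ?thesis using Suc by simp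
  qed simp
qed

lemma prot_prob_0 [simp]: "prot_prob 0 n = 1"
  by (simp add: prot_prob_def)

lemma prot_prob_Suc_0 [simp]: "prot_prob (Suc l) 0 = 0"
  by (simp add: prot_prob_def)

lemma children_prob_0 [simp]: "children_prob l 0 = 1"
  by (simp add: children_prob_def)

lemma prot_prob_bounds: "0 \<le> prot_prob l n" "prot_prob l n \<le> 1"
  using shape_mean_mono[of "\<lambda>_. 0" "\<lambda>t. of_bool (root_prot l t)" n]
    shape_mean_mono[of "\<lambda>t. of_bool (root_prot l t)" "\<lambda>_. 1" n]
  by (auto simp: prot_prob_def)

lemma children_prob_bounds: "0 \<le> children_prob l n" "children_prob l n \<le> 1"
  using shape_mean_mono[of "\<lambda>_. 0" "\<lambda>t. of_bool (children_prot l t)" n]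
    shape_mean_mono[of "\<lambda>t. of_bool (children_prot l t)" "\<lambda>_. 1" n]
  by (auto simp: children_prob_def)

lemma shape_mean_product:
  "shape_mean k (\<lambda>a. shape_mean m (\<lambda>b. of_bool (P a \<and> Q b))) =
    shape_mean k (\<lambda>a. of_bool (P a)) * shape_mean m (\<lambda>b. of_bool (Q b))"
proof -
  have "shape_mean m (\<lambda>b. of_bool (P a \<and> Q b)) = shape_mean m (\<lambda>b. of_bool (Q b)) * of_bool (P a)" for a
    by (cases "P a") simp_all
  then have "shape_mean k (\<lambda>a. shape_mean m (\<lambda>b. of_bool (P a \<and> Q b))) =
    shape_mean k (\<lambda>a. shape_mean m (\<lambda>b. of_bool (Q b)) * of_bool (P a))"
    by simp
  also have "\<dots> = shape_mean m (\<lambda>b. of_bool (Q b)) * shape_mean k (\<lambda>a. of_bool (P a))"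
    by (rule shape_mean_cmult)
  finally show ?thesis by (simp add: mult.commute)
qed

lemma children_prob_Suc:
  "real (Suc n) * children_prob l (Suc n) = (\<Sum>k\<le>n. prot_prob l k * children_prob l (n - k))"
  unfolding children_prob_def prot_prob_def shape_mean_split
  by (simp only: children_prot.simps shape_mean_product)

lemma prot_prob_Suc: "prot_prob (Suc l) (Suc n) = children_prob l (Suc n)"
proof -
  have "real (Suc n) * prot_prob (Suc l) (Suc n) = real (Suc n) * children_prob l (Suc n)"
    unfolding children_prob_def prot_prob_def shape_mean_split by simp
  then show ?thesis by simp
qed

lemma nonroot_mean_Suc:
  "real (Suc n) * nonroot_mean l (Suc n) =
    (\<Sum>k\<le>n. prot_prob l k + nonroot_mean l k + nonroot_mean l (n - k))"
  unfolding nonroot_mean_def prot_prob_def shape_mean_split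
  by (simp add: shape_mean_add)

text \<open>Differences of consecutive recursions give a first-order recursion, which telescopes
  after division by \<open>(n + 1) * (n + 2)\<close>.\<close>

lemma nonroot_mean_eq:
  "nonroot_mean l n = real (Suc n) * (\<Sum>k<n. prot_prob l k / (real (Suc k) * real (Suc (Suc k))))"
proof (induction n)
  case 0
  then show ?case by (simp add: nonroot_mean_def)
next
  case (Suc n)
  \<comment> \<open>Reversing the summation index merges the means of the two subtrees into a factor
    2.\<close>
  have rec: "real (Suc n) * nonroot_mean l (Suc n) = (\<Sum>k<Suc n. prot_prob l k + 2 * nonroot_mean l k)" for n
    unfolding nonroot_mean_Suc sum.distrib
    using sum.nat_diff_reindex[of "nonroot_mean l" "Suc n"]
    by (simp add: lessThan_Suc_atMost sum_distrib_left[symmetric])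
  have step: "real (Suc n) * nonroot_mean l (Suc n) = real (n + 2) * nonroot_mean l n + prot_prob l n"
  proof (cases n)
    case 0
    then show ?thesis using rec[of 0] by (simp add: nonroot_mean_def)
  next
    case (Suc m)
    then show ?thesis using rec[of n] rec[of m] by (simp add: algebra_simps)
  qed
  define S where "S = (\<Sum>k<n. prot_prob l k / (real (Suc k) * real (Suc (Suc k))))"
  have "nonroot_mean l (Suc n) = real (n + 2) * S + prot_prob l n / real (Suc n)"
    using step unfolding Suc.IH S_def[symmetric] by (simp add: field_simps del: of_nat_Suc)
  also have "\<dots> = real (Suc (Suc n)) * (S + prot_prob l n / (real (Suc n) * real (Suc (Suc n))))"
    by (simp add: distrib_left del: of_nat_Suc)
  finally show ?case unfolding S_def by (simp only: sum.lessThan_Suc)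
qed

section \<open>Generating functions\<close>

lemma summable_bounded_mult_power:
  fixes c :: "nat \<Rightarrow> real"
  assumes "\<And>n. 0 \<le> c n" "\<And>n. c n \<le> 1" "\<bar>x\<bar> < 1"
  shows "summable (\<lambda>n. \<bar>c n * x ^ n\<bar>)" "summable (\<lambda>n. c n * x ^ n)"
proof -
  show "summable (\<lambda>n. \<bar>c n * x ^ n\<bar>)"
  proof (rule summable_comparison_test'[OF summable_geometric[of "\<bar>x\<bar>"]])
    show "norm \<bar>c n * x ^ n\<bar> \<le> \<bar>x\<bar> ^ n" for n
      using assms mult_right_mono[of "c n" 1 "\<bar>x\<bar> ^ n"] by (simp add: abs_mult power_abs)
  qed (use assms in auto)
  then show "summable (\<lambda>n. c n * x ^ n)" by (rule summable_rabs_cancel)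
qed

definition prot_gf :: "nat \<Rightarrow> real \<Rightarrow> real" where
  "prot_gf l x = (\<Sum>n. prot_prob l n * x ^ n)"

definition children_gf :: "nat \<Rightarrow> real \<Rightarrow> real" where
  "children_gf l x = (\<Sum>n. children_prob l n * x ^ n)"

lemmas summable_prot = summable_bounded_mult_power[where c = "prot_prob l" for l, OF prot_prob_bounds]
lemmas summable_children =
  summable_bounded_mult_power[where c = "children_prob l" for l, OF children_prob_bounds]

text \<open>This linear differential equation is the convolution recursion
  \<open>children_prob_Suc\<close> read coefficientwise.\<close>

lemma children_gf_deriv:
  assumes "\<bar>x\<bar> < 1"
  shows "(children_gf l has_real_derivative prot_gf l x * children_gf l x) (at x)"
proof -
  obtain K where K: "\<bar>x\<bar> < K" "K < 1" using assms dense by blast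
  have "((\<lambda>x. \<Sum>n. children_prob l n * x ^ n) has_real_derivative
      (\<Sum>n. diffs (children_prob l) n * x ^ n)) (at x)"
    by (rule termdiffs_strong[where K = K]) (use K summable_children(2) in auto)
  moreover have "(\<Sum>n. diffs (children_prob l) n * x ^ n) = prot_gf l x * children_gf l x"
  proof -
    have "prot_gf l x * children_gf l x =
      (\<Sum>n. \<Sum>k\<le>n. (prot_prob l k * x ^ k) * (children_prob l (n - k) * x ^ (n - k)))"
      unfolding prot_gf_def children_gf_def
      using summable_prot(1)[OF assms, where l = l] summable_children(1)[OF assms, where l = l]
      by (intro Cauchy_product) auto
    also have "\<dots> = (\<Sum>n. (\<Sum>k\<le>n. prot_prob l k * children_prob l (n - k)) * x ^ n)"
      unfolding sum_distrib_right
      by (intro suminf_cong sum.cong refl) (simp add: power_add[symmetric] mult.assoc mult.left_commute)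
    finally show ?thesis by (simp add: diffs_def children_prob_Suc[symmetric])
  qed
  ultimately show ?thesis by (simp add: children_gf_def[abs_def])
qed

text \<open>The coefficients agree from index 1 on. At index 0 they are 0 and 1: a single node is a
  leaf, but the condition on its children is vacuous.\<close>

lemma prot_gf_Suc:
  assumes "\<bar>x\<bar> < 1"
  shows "prot_gf (Suc l) x = children_gf l x - 1"
  using suminf_split_head[OF summable_prot(2)[OF assms, where l = "Suc l"]]
    suminf_split_head[OF summable_children(2)[OF assms, where l = l]]
  by (simp add: prot_gf_def children_gf_def prot_prob_Suc)

lemma children_gf_0: "children_gf l 0 = 1"
  using powser_zero[of "children_prob l"] by (simp add: children_gf_def)

text \<open>Positivity is what permits taking the logarithm of \<open>children_gf\<close>
  below.\<close>

lemma children_gf_ge_1: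
  assumes "0 \<le> x" "x < 1"
  shows "1 \<le> children_gf l x"
proof -
  have "0 \<le> prot_gf (Suc l) x"
    unfolding prot_gf_def using assms prot_prob_bounds
    by (intro suminf_nonneg summable_prot) auto
  then show ?thesis using assms prot_gf_Suc[of x l] by simp
qed

text \<open>A node of age \<open>t\<close> in the continuous-time growth process has a number of
  descendants that is geometric with success probability \<open>exp (- t)\<close>.\<close>
lemma p_fun_eq_prot_gf:
  assumes "0 \<le> t"
  shows "p_fun l t = exp (- t) * prot_gf l (1 - exp (- t))"
  using assms
proof (induction l arbitrary: t)
  case 0
  then show ?case by (simp add: prot_gf_def suminf_geometric)
next
  case (Suc l)
  \<comment> \<open>By \<open>children_gf_deriv\<close> and the chain rule, the logarithm of
    \<open>children_gf l (1 - exp (- s))\<close> has derivative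
    \<open>exp (- s) * prot_gf l (1 - exp (- s))\<close>, which is \<open>p_fun l s\<close> by
    induction.\<close>
  have "(p_fun l has_integral ln (children_gf l (1 - exp (- t))) - ln (children_gf l (1 - exp (- 0)))) {0..t}"
  proof (rule fundamental_theorem_of_calculus)
    fix s :: real assume s: "s \<in> {0..t}"
    then have u: "\<bar>1 - exp (- s)\<bar> < 1" "0 \<le> 1 - exp (- s)" by auto
    have pos: "children_gf l (1 - exp (- s)) > 0"
      using children_gf_ge_1[of "1 - exp (- s)" l] s by simp
    have "((\<lambda>s. 1 - exp (- s)) has_real_derivative exp (- s)) (at s)"
      by (auto intro!: derivative_eq_intros)
    from DERIV_chain2[OF children_gf_deriv[OF u(1)] this, of l]
    have "((\<lambda>s. ln (children_gf l (1 - exp (- s)))) has_real_derivative p_fun l s) (at s)"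
      using pos Suc.IH[of s] s by (auto intro!: derivative_eq_intros)
    then show "((\<lambda>s. ln (children_gf l (1 - exp (- s)))) has_vector_derivative p_fun l s) (at s within {0..t})"
      by (simp add: has_real_derivative_iff_has_vector_derivative has_vector_derivative_at_within)
  qed (use Suc in simp)
  then have "integral {0..t} (p_fun l) = ln (children_gf l (1 - exp (- t)))"
    by (simp add: integral_unique children_gf_0)
  moreover have "children_gf l (1 - exp (- t)) \<ge> 1"
    using Suc.prems by (intro children_gf_ge_1) auto
  moreover have "\<bar>1 - exp (- t)\<bar> < 1" using Suc.prems by simp
  ultimately show ?case by (simp add: prot_gf_Suc)
qed

section \<open>The limit constant as a series\<close>

lemma has_integral_exp_beta:
  "((\<lambda>t. exp (- t) * exp (- t) * (1 - exp (- t)) ^ k) has_integral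
     1 / (real (Suc k) * real (Suc (Suc k)))) {0..}"
proof (rule has_integral_to_inf)
  \<comment> \<open>With \<open>x = 1 - exp (- t)\<close> the integral becomes that of
    \<open>(1 - x) * x ^ k\<close> over the unit interval; \<open>H\<close> is the antiderivative
    vanishing at 0.\<close>
  define H :: "real \<Rightarrow> real" where
    "H t = (1 - exp (- t)) ^ Suc k / real (Suc k) - (1 - exp (- t)) ^ Suc (Suc k) / real (Suc (Suc k))" for t
  show "(\<lambda>t. exp (- t) * exp (- t) * (1 - exp (- t)) ^ k) integrable_on {0..y}" for y :: real
    by (intro integrable_continuous_interval continuous_intros)
  have "((\<lambda>t. exp (- t) * exp (- t) * (1 - exp (- t)) ^ k) has_integral H y - H 0) {0..y}" if "0 \<le> y" for y
  proof (rule fundamental_theorem_of_calculus)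
    fix s :: real
    have "(H has_real_derivative exp (- s) * exp (- s) * (1 - exp (- s)) ^ k) (at s)"
      unfolding H_def by (rule derivative_eq_intros refl | simp)+ (simp add: field_simps)
    then show "(H has_vector_derivative exp (- s) * exp (- s) * (1 - exp (- s)) ^ k) (at s within {0..y})"
      by (simp add: has_real_derivative_iff_has_vector_derivative has_vector_derivative_at_within)
  qed fact
  then have eq: "integral {0..y} (\<lambda>t. exp (- t) * exp (- t) * (1 - exp (- t)) ^ k) = H y" if "0 \<le> y" for y
    using that by (simp add: integral_unique H_def)
  have "((\<lambda>t::real. exp (- t)) \<longlongrightarrow> 0) at_top"
    using filterlim_compose[OF exp_at_bot filterlim_uminus_at_bot_at_top] by simp
  then have "(H \<longlongrightarrow> (1 - 0) ^ Suc k / real (Suc k) - (1 - 0) ^ Suc (Suc k) / real (Suc (Suc k))) at_top"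
    unfolding H_def by (intro tendsto_intros) auto
  then have "(H \<longlongrightarrow> 1 / (real (Suc k) * real (Suc (Suc k)))) at_top"
    by (simp add: field_simps)
  then show "((\<lambda>y. integral {0..y} (\<lambda>t. exp (- t) * exp (- t) * (1 - exp (- t)) ^ k)) \<longlongrightarrow>
      1 / (real (Suc k) * real (Suc (Suc k)))) at_top"
    by (rule Lim_transform_eventually) (auto simp: eq intro!: eventually_at_top_linorderI[of 0])
qed auto

text \<open>The power series for \<open>p_fun l\<close> is integrated term by term. Its terms are
  nonnegative, so monotone convergence applies to the partial sums.\<close>

lemma p_star_sums:
  "(\<lambda>k. prot_prob l k / (real (Suc k) * real (Suc (Suc k)))) sums p_star l"
proof -
  define h :: "nat \<Rightarrow> real \<Rightarrow> real" where "h k t = exp (- t) * exp (- t) * (1 - exp (- t)) ^ k" for k t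
  define S where "S N t = (\<Sum>k<N. prot_prob l k * h k t)" for N t
  have int_S: "(S N has_integral (\<Sum>k<N. prot_prob l k / (real (Suc k) * real (Suc (Suc k))))) {0..}" for N
    unfolding S_def
    using has_integral_sum[of "{..<N}", OF _ has_integral_mult_right[OF has_integral_exp_beta]]
    by (simp add: h_def)
  \<comment> \<open>A telescoping bound, giving the bounded integrals that monotone convergence asks
    for.\<close>
  have le: "(\<Sum>k<N. prot_prob l k / (real (Suc k) * real (Suc (Suc k)))) \<le> 1 - 1 / real (Suc N)" for N
  proof (induction N)
    case (Suc N)
    have "prot_prob l N / (real (Suc N) * real (Suc (Suc N))) \<le> 1 / (real (Suc N) * real (Suc (Suc N)))"
      by (intro divide_right_mono prot_prob_bounds) simp
    also have "\<dots> = 1 / real (Suc N) - 1 / real (Suc (Suc N))" by (simp add: field_simps)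
    finally show ?case using Suc by simp
  qed simp
  have "(\<lambda>t. p_fun l t * exp (- t)) integrable_on {0..} \<and>
    (\<lambda>N. integral {0..} (S N)) \<longlonglongrightarrow> integral {0..} (\<lambda>t. p_fun l t * exp (- t))"
  proof (rule monotone_convergence_increasing)
    show "S N integrable_on {0..}" for N using int_S by (rule has_integral_integrable)
    show "S N t \<le> S (Suc N) t" if "t \<in> {0..}" for N t
      using that by (simp add: S_def h_def prot_prob_bounds)
    show "(\<lambda>N. S N t) \<longlonglongrightarrow> p_fun l t * exp (- t)" if "t \<in> {0..}" for t
    proof -
      have "(\<lambda>k. prot_prob l k * (1 - exp (- t)) ^ k) sums prot_gf l (1 - exp (- t))"
        unfolding prot_gf_def using that by (intro summable_sums summable_prot) simp
      then have "(\<lambda>k. exp (- t) * exp (- t) * (prot_prob l k * (1 - exp (- t)) ^ k)) sums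
          (exp (- t) * exp (- t) * prot_gf l (1 - exp (- t)))"
        by (rule sums_mult)
      then show ?thesis
        using that by (simp add: sums_def S_def h_def p_fun_eq_prot_gf mult_ac)
    qed
    show "bounded (range (\<lambda>N. integral {0..} (S N)))"
    proof (rule boundedI)
      fix x assume "x \<in> range (\<lambda>N. integral {0..} (S N))"
      then obtain N where x: "x = (\<Sum>k<N. prot_prob l k / (real (Suc k) * real (Suc (Suc k))))"
        using integral_unique[OF int_S] by auto
      have "0 \<le> x" unfolding x by (intro sum_nonneg divide_nonneg_nonneg prot_prob_bounds) auto
      moreover have "x \<le> 1" using le[of N] unfolding x by (rule order_trans) simp
      ultimately show "norm x \<le> 1" by simp
    qed
  qed
  then show ?thesis by (simp add: sums_def p_star_def integral_unique[OF int_S])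
qed

section \<open>Closed forms at levels 1 and 2\<close>

lemma p_fun_1: "0 \<le> t \<Longrightarrow> p_fun 1 t = 1 - exp (- t)"
  by (simp add: algebra_simps exp_minus)

lemma p_fun_2:
  assumes "0 \<le> t"
  shows "p_fun 2 t = exp (exp (- t) - 1) - exp (- t)"
proof -
  have "((\<lambda>s. 1 - exp (- s)) has_integral (t + exp (- t)) - (0 + exp (- 0))) {0..t}"
    using assms
    by (intro fundamental_theorem_of_calculus)
      (auto intro!: derivative_eq_intros simp: has_real_derivative_iff_has_vector_derivative[symmetric])
  moreover have "integral {0..t} (p_fun 1) = integral {0..t} (\<lambda>s. 1 - exp (- s))"
    by (intro integral_cong p_fun_1) auto
  ultimately have "integral {0..t} (p_fun 1) = t + exp (- t) - 1"
    by (simp add: integral_unique)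
  moreover have "p_fun 2 t = exp (- t) * (exp (integral {0..t} (p_fun 1)) - 1)"
    by (simp add: numeral_2_eq_2)
  ultimately have "p_fun 2 t = exp (- t) * (exp (t + exp (- t) - 1) - 1)" by simp
  also have "\<dots> = exp (exp (- t) - 1) - exp (- t)"
    by (simp add: right_diff_distrib exp_add[symmetric])
  finally show ?thesis .
qed

lemma p_star_2: "p_star 2 = 1 / 2 - exp (- 1)"
proof -
  \<comment> \<open>In the variable \<open>u = exp (- t)\<close> this is an antiderivative of
    \<open>u - exp (u - 1)\<close>. The constant \<open>exp (- 1)\<close> makes \<open>H\<close>
    vanish at infinity, so the integral is \<open>- H 0\<close>.\<close>
  define H :: "real \<Rightarrow> real" where "H t = exp (- t) ^ 2 / 2 + exp (- 1)  - exp (exp (- t) - 1)" for t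
  define h :: "real \<Rightarrow> real" where "h t = (exp (exp (- t) - 1) - exp (- t)) * exp (- t)" for t
  have cont: "continuous_on A h" for A unfolding h_def by (intro continuous_intros)
  have "(h has_integral (1 / 2 - exp (- 1))) {0..}"
  proof (rule has_integral_to_inf)
    show "h integrable_on {0..y}" for y
      by (intro integrable_continuous_interval cont)
    have "(h has_integral H y - H 0) {0..y}" if "0 \<le> y" for y
    proof (rule fundamental_theorem_of_calculus)
      fix s :: real
      have "(H has_real_derivative h s) (at s)"
        unfolding H_def h_def by (auto intro!: derivative_eq_intros simp: algebra_simps power2_eq_square)
      then show "(H has_vector_derivative h s) (at s within {0..y})"
        by (simp add: has_real_derivative_iff_has_vector_derivative has_vector_derivative_at_within)
    qed fact
    then have eq: "integral {0..y} h = H y + (1 / 2 - exp (- 1))" if "0 \<le> y" for y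
      using that by (simp add: integral_unique H_def)
    have "((\<lambda>t::real. exp (- t)) \<longlongrightarrow> 0) at_top"
      using filterlim_compose[OF exp_at_bot filterlim_uminus_at_bot_at_top] by simp
    then have "((\<lambda>y. H y + (1 / 2 - exp (- 1))) \<longlongrightarrow>
        0\<^sup>2 / 2 + exp (- 1) - exp (0 - 1) + (1 / 2 - exp (- 1))) at_top"
      unfolding H_def by (intro tendsto_intros) auto
    then have "((\<lambda>y. H y + (1 / 2 - exp (- 1))) \<longlongrightarrow> 1 / 2 - exp (- 1)) at_top" by simp
    then show "((\<lambda>y. integral {0..y} h) \<longlongrightarrow> 1 / 2 - exp (- 1)) at_top"
      by (rule Lim_transform_eventually) (auto simp: eq intro!: eventually_at_top_linorderI[of 0])
    show "0 \<le> h y" if "0 \<le> y" for y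
      using exp_ge_add_one_self[of "exp (- y) - 1"] by (simp add: h_def)
  qed
  moreover have "p_star 2 = integral {0..} h"
    unfolding p_star_def h_def by (intro integral_cong) (simp add: p_fun_2)
  ultimately show ?thesis by (simp add: integral_unique)
qed

section \<open>Bounded differences\<close>

lemma expectation_pair_pmf_finite:
  fixes F :: "'a \<times> 'b \<Rightarrow> real"
  assumes "finite (set_pmf p)" "finite (set_pmf q)"
  shows "measure_pmf.expectation (pair_pmf p q) F =
    measure_pmf.expectation q (\<lambda>y. measure_pmf.expectation p (\<lambda>x. F (x, y)))"
proof -
  have "measure_pmf.expectation (pair_pmf p q) F =
      (\<Sum>z\<in>set_pmf p \<times> set_pmf q. F z * pmf (pair_pmf p q) z)"
    using assms by (intro integral_measure_pmf_real) auto
  also have "\<dots> = (\<Sum>x\<in>set_pmf p. \<Sum>y\<in>set_pmf q. F (x, y) * (pmf p x * pmf q y))"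
    unfolding sum.cartesian_product by (intro sum.cong refl) (auto simp: pmf_pair)
  also have "\<dots> = (\<Sum>y\<in>set_pmf q. (\<Sum>x\<in>set_pmf p. F (x, y) * pmf p x) * pmf q y)"
    by (subst sum.swap) (simp add: sum_distrib_right mult.assoc)
  also have "\<dots> = (\<Sum>y\<in>set_pmf q. measure_pmf.expectation p (\<lambda>x. F (x, y)) * pmf q y)"
    using assms by (intro sum.cong refl) (subst integral_measure_pmf_real, auto)
  also have "\<dots> = measure_pmf.expectation q (\<lambda>y. measure_pmf.expectation p (\<lambda>x. F (x, y)))"
    using assms by (intro integral_measure_pmf_real[symmetric]) auto
  finally show ?thesis .
qed

lemma finite_set_Pi_pmf:
  assumes "finite A" "\<And>i. i \<in> A \<Longrightarrow> finite (set_pmf (p i))"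
  shows "finite (set_pmf (Pi_pmf A d p))"
  using assms by (simp add: set_Pi_pmf finite_PiE_dflt)

lemma expectation_Pi_pmf_insert:
  fixes F :: "('a \<Rightarrow> 'b) \<Rightarrow> real"
  assumes "finite A" "x \<notin> A" "\<And>i. i \<in> insert x A \<Longrightarrow> finite (set_pmf (p i))"
  shows "measure_pmf.expectation (Pi_pmf (insert x A) d p) F =
    measure_pmf.expectation (Pi_pmf A d p) (\<lambda>f. measure_pmf.expectation (p x) (\<lambda>y. F (f(x := y))))"
  using assms by (simp add: Pi_pmf_insert expectation_pair_pmf_finite finite_set_Pi_pmf case_prod_unfold)

text \<open>Averaging the oscillation bound over one argument puts every value within
  \<open>c\<close> of the mean.\<close>

lemma variance_le_of_oscillation:
  fixes G :: "'a \<Rightarrow> real"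
  assumes "finite (set_pmf p)" "\<And>x y. \<bar>G x - G y\<bar> \<le> c"
  shows "measure_pmf.variance p G \<le> c\<^sup>2"
proof -
  let ?m = "measure_pmf.expectation p G"
  have int: "integrable p g" for g :: "'a \<Rightarrow> real"
    using assms(1) by (rule integrable_measure_pmf_finite)
  have "\<bar>G x - ?m\<bar> \<le> c" for x
  proof -
    have "G x - c \<le> G y" "G y \<le> G x + c" for y using assms(2)[of x y] by auto
    then have "measure_pmf.expectation p (\<lambda>_. G x - c) \<le> ?m" "?m \<le> measure_pmf.expectation p (\<lambda>_. G x + c)"
      by (intro integral_mono int; simp)+
    then show ?thesis by simp
  qed
  then have "(G x - ?m)\<^sup>2 \<le> c\<^sup>2" for x by (metis abs_ge_zero power2_abs power_mono)
  then have "measure_pmf.variance p G \<le> measure_pmf.expectation p (\<lambda>_. c\<^sup>2)"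
    by (intro integral_mono int)
  then show ?thesis by simp
qed

text \<open>An Efron-Stein type bound by induction on the coordinates. Averaging out coordinate
  \<open>x\<close> yields \<open>F'\<close>, which keeps the bounded differences, and the
  conditional variance costs at most \<open>c\<^sup>2\<close>.\<close>

lemma variance_Pi_pmf_bounded_differences:
  fixes F :: "('a \<Rightarrow> 'b) \<Rightarrow> real"
  assumes "finite A" "\<And>i. i \<in> A \<Longrightarrow> finite (set_pmf (p i))"
    and "\<And>f i y. i \<in> A \<Longrightarrow> \<bar>F f - F (f(i := y))\<bar> \<le> c"
  shows "measure_pmf.variance (Pi_pmf A d p) F \<le> real (card A) * c\<^sup>2"
  using assms
proof (induction A arbitrary: F rule: finite_induct)
  case empty
  then show ?case by (simp add: pmf_Pi_empty)
next
  case (insert x A)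
  let ?P = "Pi_pmf A d p" and ?E = "measure_pmf.expectation"
  define F' where "F' f = ?E (p x) (\<lambda>y. F (f(x := y)))" for f
  have int: "integrable ?P g" "integrable (p x) h" for g :: "_ \<Rightarrow> real" and h :: "_ \<Rightarrow> real"
    using insert by (auto intro!: integrable_measure_pmf_finite finite_set_Pi_pmf)
  have E: "?E (Pi_pmf (insert x A) d p) G = ?E ?P (\<lambda>f. ?E (p x) (\<lambda>y. G (f(x := y))))" for G :: "_ \<Rightarrow> real"
    using insert by (intro expectation_Pi_pmf_insert) auto
  have mean: "?E (Pi_pmf (insert x A) d p) F = ?E ?P F'"
    unfolding E F'_def ..
  have osc: "\<bar>F (f(x := y)) - F (f(x := z))\<bar> \<le> c" for f y z
    using insert.prems(2)[of x "f(x := y)" z] by (simp only: insertI1 fun_upd_upd simp_thms)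
  have inner: "?E (p x) (\<lambda>y. (F (f(x := y)) - m)\<^sup>2) \<le> c\<^sup>2 + (F' f - m)\<^sup>2" for f m
  proof -
    \<comment> \<open>Decomposition around the conditional mean \<open>F' f\<close>. The remainder
      is written as an affine function of \<open>F (f(x := y))\<close>, so that its expectation is
      immediate.\<close>
    have "?E (p x) (\<lambda>y. (F (f(x := y)) - m)\<^sup>2) =
      ?E (p x) (\<lambda>y. (F (f(x := y)) - F' f)\<^sup>2 + ((F' f - m) * (2 * F (f(x := y))) + (m\<^sup>2 - (F' f)\<^sup>2)))"
      by (intro Bochner_Integration.integral_cong refl) (simp add: power2_eq_square algebra_simps)
    also have "\<dots> = ?E (p x) (\<lambda>y. (F (f(x := y)) - F' f)\<^sup>2) + ((F' f - m) * (2 * F' f) + (m\<^sup>2 - (F' f)\<^sup>2))"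
      by (simp add: int F'_def)
    also have "(F' f - m) * (2 * F' f) + (m\<^sup>2 - (F' f)\<^sup>2) = (F' f - m)\<^sup>2"
      by (simp add: power2_eq_square algebra_simps)
    also have "?E (p x) (\<lambda>y. (F (f(x := y)) - F' f)\<^sup>2) + (F' f - m)\<^sup>2 \<le> c\<^sup>2 + (F' f - m)\<^sup>2"
      unfolding F'_def by (intro add_right_mono variance_le_of_oscillation osc insert.prems(1) insertI1)
    finally show ?thesis .
  qed
  have "\<bar>F' f - F' (f(i := z))\<bar> \<le> c" if "i \<in> A" for f i z
  proof -
    have ne: "i \<noteq> x" using that insert by auto
    have "\<bar>F' f - F' (f(i := z))\<bar> = \<bar>?E (p x) (\<lambda>y. F (f(x := y)) - F (f(i := z, x := y)))\<bar>"
      unfolding F'_def by (simp add: int)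
    also have "\<dots> \<le> ?E (p x) (\<lambda>y. \<bar>F (f(x := y)) - F (f(i := z, x := y))\<bar>)"
      by (rule integral_abs_bound)
    also have "\<dots> \<le> ?E (p x) (\<lambda>_. c)"
      unfolding fun_upd_twist[OF ne] using that by (intro integral_mono int insert.prems(2)) simp
    finally show ?thesis by simp
  qed
  then have IH: "measure_pmf.variance ?P F' \<le> real (card A) * c\<^sup>2"
    by (intro insert.IH insert.prems(1) insertI2)
  have "measure_pmf.variance (Pi_pmf (insert x A) d p) F \<le> ?E ?P (\<lambda>f. c\<^sup>2 + (F' f - ?E ?P F')\<^sup>2)"
    unfolding mean E[of "\<lambda>f. (F f - _)\<^sup>2"] by (intro integral_mono int inner)
  also have "\<dots> = c\<^sup>2 + measure_pmf.variance ?P F'"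
    by (simp add: int)
  also have "\<dots> \<le> real (card (insert x A)) * c\<^sup>2"
    using IH insert by (simp add: algebra_simps)
  finally show ?case .
qed

section \<open>Sensitivity of the protected count to one parent\<close>

definition prot_count :: "nat \<Rightarrow> nat \<Rightarrow> (nat \<Rightarrow> nat) \<Rightarrow> nat" where
  "prot_count l n f = card {v \<in> {1..n}. prot l (child_rel n f) v}"

text \<open>Moving one node to another parent changes the children of only two nodes, so at level \<open>l\<close> the
  affected nodes are among these two and the parents of the nodes affected at level \<open>l - 1\<close>.\<close>
lemma prot_changes:
  "\<exists>S. finite S \<and> card S \<le> 2 * l \<and>
    (\<forall>v. prot l (child_rel n f) v \<noteq> prot l (child_rel n (f(i := y))) v \<longrightarrow> v \<in> S)"
proof (induction l)
  case 0
  then show ?case by (intro exI[of _ "{}"]) auto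
next
  case (Suc l)
  let ?R = "child_rel n f" and ?R' = "child_rel n (f(i := y))"
  from Suc obtain S where S: "finite S" "card S \<le> 2 * l" "\<And>v. prot l ?R v \<noteq> prot l ?R' v \<Longrightarrow> v \<in> S"
    by blast
  let ?S = "{f i, y} \<union> f ` S"
  have in_S: "v \<in> ?S" if "prot (Suc l) ?R v \<noteq> prot (Suc l) ?R' v" for v
  proof (rule ccontr)
    assume v: "v \<notin> ?S"
    then have eq: "(v, w) \<in> ?R \<longleftrightarrow> (v, w) \<in> ?R'" for w
      by (auto simp: child_rel_def)
    have "prot l ?R w = prot l ?R' w" if "(v, w) \<in> ?R" for w
      using S(3)[of w] v that by (auto simp: child_rel_def)
    then have "prot (Suc l) ?R v = prot (Suc l) ?R' v"
      using eq by auto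
    then show False using that by simp
  qed
  have "card {f i, y} \<le> 2" by (simp add: card_insert_if)
  moreover have "card ?S \<le> card {f i, y} + card (f ` S)" by (rule card_Un_le)
  ultimately have "card ?S \<le> 2 + 2 * l"
    using S(2) card_image_le[OF S(1), of f] by linarith
  then have card_S: "card ?S \<le> 2 * Suc l" by simp
  show ?case
  proof (intro exI conjI allI impI)
    show "finite ?S" using S(1) by simp
    show "card ?S \<le> 2 * Suc l" by fact
    show "v \<in> ?S" if "prot (Suc l) ?R v \<noteq> prot (Suc l) ?R' v" for v using that by (rule in_S)
  qed
qed

lemma card_diff_le_of_changes:
  assumes "finite V" "finite S" "\<And>v. P v \<noteq> Q v \<Longrightarrow> v \<in> S"
  shows "\<bar>real (card {v \<in> V. P v}) - real (card {v \<in> V. Q v})\<bar> \<le> real (card S)"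
proof -
  have "card {v \<in> V. P v} \<le> card {v \<in> V. Q v} + card S" if "\<And>v. P v \<noteq> Q v \<Longrightarrow> v \<in> S" for P Q
  proof -
    have "card {v \<in> V. P v} \<le> card ({v \<in> V. Q v} \<union> S)"
      using assms that by (intro card_mono) auto
    also have "\<dots> \<le> card {v \<in> V. Q v} + card S" by (rule card_Un_le)
    finally show ?thesis .
  qed
  from this[of P Q] this[of Q P] assms(3)
  have "card {v \<in> V. P v} \<le> card {v \<in> V. Q v} + card S"
    "card {v \<in> V. Q v} \<le> card {v \<in> V. P v} + card S"
    by auto
  then show ?thesis by linarith
qed

lemma prot_count_bounded_differences:
  "\<bar>real (prot_count l n f) - real (prot_count l n (f(i := y)))\<bar> \<le> 2 * real l"
proof -
  obtain S where S: "finite S" "card S \<le> 2 * l"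
    "\<And>v. prot l (child_rel n f) v \<noteq> prot l (child_rel n (f(i := y))) v \<Longrightarrow> v \<in> S"
    using prot_changes[of l n f i y] by blast
  have "\<bar>real (prot_count l n f) - real (prot_count l n (f(i := y)))\<bar> \<le> real (card S)"
    unfolding prot_count_def by (rule card_diff_le_of_changes[OF finite_atLeastAtMost S(1) S(3)])
  also have "\<dots> \<le> 2 * real l" using S(2) by linarith
  finally show ?thesis .
qed

section \<open>The random recursive tree\<close>

lemma set_random_recursive_tree:
  assumes "f \<in> set_pmf (random_recursive_tree n)" "i \<in> {2..n}"
  shows "f i \<in> {1..<i}"
  using assms by (auto simp: random_recursive_tree_def set_Pi_pmf PiE_dflt_def set_pmf_of_set)

lemma finite_set_random_recursive_tree: "finite (set_pmf (random_recursive_tree n))"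
  unfolding random_recursive_tree_def by (intro finite_set_Pi_pmf) (auto simp: set_pmf_of_set)

lemma integrable_random_recursive_tree:
  "integrable (random_recursive_tree n) (F :: _ \<Rightarrow> real)"
  by (rule integrable_measure_pmf_finite[OF finite_set_random_recursive_tree])

lemma random_recursive_tree_expectation_cong:
  assumes "\<And>f. (\<And>i. i \<in> {2..n} \<Longrightarrow> f i \<in> {1..<i}) \<Longrightarrow> F f = G f"
  shows "measure_pmf.expectation (random_recursive_tree n) F =
    measure_pmf.expectation (random_recursive_tree n) (G :: _ \<Rightarrow> real)"
  using assms set_random_recursive_tree
  by (intro integral_cong_AE) (auto simp: AE_measure_pmf_iff)

text \<open>Given the earlier choices, node \<open>n + 2\<close> picks its parent uniformly among
  \<open>n + 1\<close> nodes, so averaging over this choice is \<open>growth_sum\<close> divided by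
  \<open>n + 1\<close>.\<close>

lemma expectation_shape:
  "measure_pmf.expectation (random_recursive_tree (Suc n)) (\<lambda>f. \<phi> (map_rtree (\<lambda>_. ()) (tree_of f n))) =
    shape_mean n \<phi>"
proof (induction n arbitrary: \<phi>)
  case 0
  then show ?case by simp
next
  case (Suc n)
  let ?s = "map_rtree (\<lambda>_. ())" and ?E = "measure_pmf.expectation"
  have ins: "{2..Suc (Suc n)} = insert (n + 2) {2..Suc n}" by auto
  have "?E (random_recursive_tree (Suc (Suc n))) (\<lambda>f. \<phi> (?s (tree_of f (Suc n)))) =
    ?E (random_recursive_tree (Suc n)) (\<lambda>f. ?E (pmf_of_set {1..<n + 2})
      (\<lambda>y. \<phi> (?s (tree_of (f(n + 2 := y)) (Suc n)))))"
    unfolding random_recursive_tree_def ins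
    by (subst expectation_Pi_pmf_insert) (auto simp: set_pmf_of_set)
  also have "\<dots> = ?E (random_recursive_tree (Suc n)) (\<lambda>f. growth_sum \<phi> (?s (tree_of f n)) / real (Suc n))"
  proof (rule random_recursive_tree_expectation_cong)
    fix f assume "\<And>i. i \<in> {2..Suc n} \<Longrightarrow> f i \<in> {1..<i}"
    note t = tree_of_correct[OF this]
    have "?E (pmf_of_set {1..<n + 2}) (\<lambda>y. \<phi> (?s (tree_of (f(n + 2 := y)) (Suc n)))) =
      ?E (pmf_of_set {1..<n + 2}) (\<lambda>y. \<phi> (?s (add_child (n + 2) y (tree_of f n))))"
      using tree_of_cong[of n "f(n + 2 := _)" f] by simp
    also have "\<dots> = (\<Sum>y\<in>{1..Suc n}. \<phi> (?s (add_child (n + 2) y (tree_of f n)))) / real (Suc n)"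
      by (subst integral_pmf_of_set) (auto simp: atLeastLessThanSuc_atLeastAtMost)
    also have "\<dots> = growth_sum \<phi> (?s (tree_of f n)) / real (Suc n)"
      using t growth_sum_add_child[of "tree_of f n" \<phi> "n + 2"] by simp
    finally show "?E (pmf_of_set {1..<n + 2}) (\<lambda>y. \<phi> (?s (tree_of (f(n + 2 := y)) (Suc n)))) =
      growth_sum \<phi> (?s (tree_of f n)) / real (Suc n)" .
  qed
  also have "\<dots> = shape_mean n (growth_sum \<phi>) / real (Suc n)"
    using Suc.IH[of "growth_sum \<phi>"] by simp
  finally show ?case by simp
qed

lemma expectation_prot_count:
  "measure_pmf.expectation (random_recursive_tree (Suc n)) (\<lambda>f. real (prot_count l (Suc n) f)) =
    prot_prob l n + nonroot_mean l n"
proof -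
  have "measure_pmf.expectation (random_recursive_tree (Suc n)) (\<lambda>f. real (prot_count l (Suc n) f)) =
    measure_pmf.expectation (random_recursive_tree (Suc n)) (\<lambda>f.
      (\<lambda>t. of_bool (root_prot l t) + real (nonroot_prot_count l t)) (map_rtree (\<lambda>_. ()) (tree_of f n)))"
  proof (rule random_recursive_tree_expectation_cong)
    fix f assume "\<And>i. i \<in> {2..Suc n} \<Longrightarrow> f i \<in> {1..<i}"
    from tree_of_correct[OF this] prot_count_edges[of "tree_of f n" l]
    show "real (prot_count l (Suc n) f) =
      (\<lambda>t. of_bool (root_prot l t) + real (nonroot_prot_count l t)) (map_rtree (\<lambda>_. ()) (tree_of f n))"
      by (simp add: prot_count_def)
  qed
  also have "\<dots> = shape_mean n (\<lambda>t. of_bool (root_prot l t) + real (nonroot_prot_count l t))"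
    by (rule expectation_shape)
  finally show ?thesis
    by (simp only: shape_mean_add prot_prob_def nonroot_mean_def)
qed

section \<open>Graph distance and the recursive form of protection\<close>

lemma ex_depth:
  fixes f :: "nat \<Rightarrow> nat"
  assumes "\<And>i. i \<in> {2..n} \<Longrightarrow> f i \<in> {1..<i}"
  shows "\<exists>d :: nat \<Rightarrow> nat. \<forall>i\<in>{2..n}. d i = Suc (d (f i))"
  using assms
proof (induction n)
  case (Suc n)
  then obtain d where d: "\<forall>i\<in>{2..n}. d i = Suc (d (f i))" by fastforce
  have "(d(Suc n := Suc (d (f (Suc n))))) i = Suc ((d(Suc n := Suc (d (f (Suc n))))) (f i))"
    if "i \<in> {2..Suc n}" for i
    using d Suc.prems[OF that] that by (cases "i = Suc n") auto
  then show ?case by blast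
qed auto

lemma relpow_depth_le:
  fixes d :: "'a \<Rightarrow> nat"
  assumes "\<And>v w. (v, w) \<in> R \<Longrightarrow> d w = Suc (d v)"
  shows "(v, w) \<in> (R \<union> R\<inverse>) ^^ k \<Longrightarrow> d w \<le> d v + k"
proof (induction k arbitrary: w)
  case (Suc k)
  then obtain u where u: "(v, u) \<in> (R \<union> R\<inverse>) ^^ k" "(u, w) \<in> R \<union> R\<inverse>" by auto
  then have "d w \<le> Suc (d u)" using assms[of u w] assms[of w u] by auto
  then show ?case using Suc.IH[OF u(1)] by simp
qed simp

lemma relpow_depth_eq:
  fixes d :: "'a \<Rightarrow> nat"
  assumes "\<And>v w. (v, w) \<in> R \<Longrightarrow> d w = Suc (d v)"
  shows "(v, w) \<in> R ^^ k \<Longrightarrow> d w = d v + k"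
  by (induction k arbitrary: w) (auto dest!: assms)

text \<open>The downward path is itself a walk of length \<open>k\<close>. Depth changes by one
  along each edge, so no undirected walk can be shorter.\<close>

lemma tree_dist_descendant:
  assumes "\<And>i. i \<in> {2..n} \<Longrightarrow> f i \<in> {1..<i}" "(v, w) \<in> child_rel n f ^^ k"
  shows "tree_dist n f v w = k"
  unfolding tree_dist_def
proof (rule Least_equality)
  let ?R = "child_rel n f"
  show "(v, w) \<in> (?R \<union> ?R\<inverse>) ^^ k"
    using assms(2) by (induction k arbitrary: w) auto
  obtain d :: "nat \<Rightarrow> nat" where "\<forall>i\<in>{2..n}. d i = Suc (d (f i))" using ex_depth[OF assms(1)] by blast
  then have d: "d y = Suc (d x)" if "(x, y) \<in> ?R" for x y using that by (auto simp: child_rel_def)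
  show "k \<le> j" if "(v, w) \<in> (?R \<union> ?R\<inverse>) ^^ j" for j
    using relpow_depth_le[of ?R d, OF d that] relpow_depth_eq[of ?R d, OF d assms(2)] by simp
qed

lemma prot_iff_leaf_distance:
  "prot l R v \<longleftrightarrow> (\<forall>w k. (v, w) \<in> R ^^ k \<and> (\<nexists>u. (w, u) \<in> R) \<longrightarrow> l \<le> k)"
proof (induction l arbitrary: v)
  case (Suc l)
  show ?case
  proof
    assume prot: "prot (Suc l) R v"
    show "\<forall>w k. (v, w) \<in> R ^^ k \<and> (\<nexists>u. (w, u) \<in> R) \<longrightarrow> Suc l \<le> k"
    proof (intro allI impI, elim conjE)
      fix w k assume w: "(v, w) \<in> R ^^ k" "\<nexists>u. (w, u) \<in> R"
      then obtain j where j: "k = Suc j" using prot by (cases k) auto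
      then obtain c where "(v, c) \<in> R" "(c, w) \<in> R ^^ j" using w(1) relpow_Suc_D2 by metis
      then show "Suc l \<le> k" using prot Suc.IH w(2) j by auto
    qed
  next
    assume *: "\<forall>w k. (v, w) \<in> R ^^ k \<and> (\<nexists>u. (w, u) \<in> R) \<longrightarrow> Suc l \<le> k"
    \<comment> \<open>The instance \<open>k = 0\<close> excludes that \<open>v\<close> itself is a
      leaf.\<close>
    have "\<exists>w. (v, w) \<in> R" using *[rule_format, of v 0] by auto
    moreover have "prot l R c" if "(v, c) \<in> R" for c
      unfolding Suc.IH using * relpow_Suc_I2[OF that] by fastforce
    ultimately show "prot (Suc l) R v" by simp
  qed
qed simp

lemma l_protected_iff_prot:
  assumes f: "\<And>i. i \<in> {2..n} \<Longrightarrow> f i \<in> {1..<i}" and v: "v \<in> {1..n}"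
  shows "l_protected l n f v \<longleftrightarrow> prot l (child_rel n f) v"
proof -
  \<comment> \<open>\<open>is_leaf\<close> also demands a label in \<open>{1..n}\<close>, unlike
    mere absence of outgoing edges.\<close>
  have in_range: "w \<in> {1..n}" if "(v, w) \<in> (child_rel n f)\<^sup>*" for w
    using that v by cases (auto simp: child_rel_def)
  show ?thesis
    unfolding l_protected_def prot_iff_leaf_distance
  proof (intro iffI allI impI; elim conjE)
    fix w k
    assume *: "\<forall>w. is_leaf n f w \<and> descendant n f v w \<longrightarrow> l \<le> tree_dist n f v w"
      and w: "(v, w) \<in> child_rel n f ^^ k" "\<nexists>u. (w, u) \<in> child_rel n f"
    have "(v, w) \<in> (child_rel n f)\<^sup>*" using w(1) by (rule relpow_imp_rtrancl)
    then show "l \<le> k"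
      using * w(2) in_range tree_dist_descendant[OF f w(1)]
      by (auto simp: is_leaf_def descendant_def)
  next
    fix w
    assume *: "\<forall>w k. (v, w) \<in> child_rel n f ^^ k \<and> (\<nexists>u. (w, u) \<in> child_rel n f) \<longrightarrow> l \<le> k"
      and w: "is_leaf n f w" "descendant n f v w"
    from w(2) obtain k where "(v, w) \<in> child_rel n f ^^ k"
      unfolding descendant_def using rtrancl_imp_relpow by blast
    then show "l \<le> tree_dist n f v w"
      using * w(1) tree_dist_descendant[OF f] by (auto simp: is_leaf_def)
  qed
qed

lemma protected_proportion_eq:
  assumes "\<And>i. i \<in> {2..n} \<Longrightarrow> f i \<in> {1..<i}"
  shows "protected_proportion l n f = real (prot_count l n f) / real n"
proof -
  have "{v \<in> {1..n}. l_protected l n f v} = {v \<in> {1..n}. prot l (child_rel n f) v}"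
    using l_protected_iff_prot[OF assms] by blast
  then show ?thesis by (simp add: protected_proportion_def prot_count_def)
qed

section \<open>Limits\<close>

lemma expectation_protected_proportion:
  "measure_pmf.expectation (random_recursive_tree (Suc n)) (protected_proportion l (Suc n)) =
    prot_prob l n / real (Suc n) + (\<Sum>k<n. prot_prob l k / (real (Suc k) * real (Suc (Suc k))))"
proof -
  have "measure_pmf.expectation (random_recursive_tree (Suc n)) (protected_proportion l (Suc n)) =
    measure_pmf.expectation (random_recursive_tree (Suc n)) (\<lambda>f. real (prot_count l (Suc n) f) / real (Suc n))"
    by (intro random_recursive_tree_expectation_cong protected_proportion_eq)
  also have "\<dots> = (prot_prob l n + nonroot_mean l n) / real (Suc n)"
    by (simp add: expectation_prot_count)
  finally show ?thesis
    by (simp only: nonroot_mean_eq add_divide_distrib nonzero_mult_div_cancel_left of_nat_neq_0 simp_thms)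
qed

lemma expectation_protected_proportion_tendsto:
  "(\<lambda>n. measure_pmf.expectation (random_recursive_tree n) (protected_proportion l n)) \<longlonglongrightarrow> p_star l"
proof (subst filterlim_sequentially_Suc[symmetric])
  \<comment> \<open>The contribution of the root vanishes in the limit.\<close>
  have "(\<lambda>n. prot_prob l n / real (Suc n)) \<longlonglongrightarrow> 0"
  proof (rule tendsto_sandwich)
    show "\<forall>\<^sub>F n in sequentially. prot_prob l n / real (Suc n) \<le> 1 / real (Suc n)"
      by (intro always_eventually allI divide_right_mono prot_prob_bounds) simp
    show "\<forall>\<^sub>F n in sequentially. 0 \<le> prot_prob l n / real (Suc n)"
      by (intro always_eventually allI divide_nonneg_nonneg prot_prob_bounds) simp
    show "(\<lambda>n. 1 / real (Suc n)) \<longlonglongrightarrow> 0" by (rule LIMSEQ_Suc[OF lim_1_over_n])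
  qed simp
  moreover have "(\<lambda>n. \<Sum>k<n. prot_prob l k / (real (Suc k) * real (Suc (Suc k)))) \<longlonglongrightarrow> p_star l"
    using p_star_sums by (simp add: sums_def)
  ultimately show "(\<lambda>n. measure_pmf.expectation (random_recursive_tree (Suc n)) (protected_proportion l (Suc n)))
      \<longlonglongrightarrow> p_star l"
    unfolding expectation_protected_proportion using tendsto_add by fastforce
qed

lemma variance_prot_count:
  "measure_pmf.variance (random_recursive_tree n) (\<lambda>f. real (prot_count l n f)) \<le> real n * (2 * real l)\<^sup>2"
proof -
  have "measure_pmf.variance (random_recursive_tree n) (\<lambda>f. real (prot_count l n f)) \<le>
    real (card {2..n}) * (2 * real l)\<^sup>2"
    unfolding random_recursive_tree_def
    by (intro variance_Pi_pmf_bounded_differences prot_count_bounded_differences)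
      (auto simp: set_pmf_of_set)
  also have "\<dots> \<le> real n * (2 * real l)\<^sup>2" by (intro mult_right_mono) auto
  finally show ?thesis .
qed

text \<open>The count has variance of order at most \<open>n\<close>, so the proportion has variance
  of order at most \<open>1 / n\<close>; Chebyshev's inequality finishes.\<close>

lemma protected_proportion_deviation:
  assumes "0 < n" "0 < a"
  shows "measure_pmf.prob (random_recursive_tree n)
      {f. a \<le> \<bar>protected_proportion l n f -
        measure_pmf.expectation (random_recursive_tree n) (protected_proportion l n)\<bar>}
    \<le> (2 * real l)\<^sup>2 / a\<^sup>2 / real n"
proof -
  let ?P = "random_recursive_tree n" and ?X = "protected_proportion l n"
  let ?C = "\<lambda>f. real (prot_count l n f)"
  have mean: "measure_pmf.expectation ?P ?X = measure_pmf.expectation ?P ?C / real n"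
  proof -
    have "measure_pmf.expectation ?P ?X = measure_pmf.expectation ?P (\<lambda>f. ?C f / real n)"
      by (intro random_recursive_tree_expectation_cong protected_proportion_eq)
    then show ?thesis by simp
  qed
  have "measure_pmf.variance ?P ?X = measure_pmf.expectation ?P
      (\<lambda>f. (?C f - measure_pmf.expectation ?P ?C)\<^sup>2 / (real n)\<^sup>2)"
    unfolding mean
    by (intro random_recursive_tree_expectation_cong)
      (simp only: protected_proportion_eq power_divide[symmetric] diff_divide_distrib)
  also have "\<dots> = measure_pmf.variance ?P ?C / (real n)\<^sup>2" by simp
  also have "\<dots> \<le> real n * (2 * real l)\<^sup>2 / (real n)\<^sup>2"
    by (intro divide_right_mono variance_prot_count) simp
  finally have "measure_pmf.variance ?P ?X \<le> (2 * real l)\<^sup>2 / real n"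
    using assms by (simp add: power2_eq_square)
  then have "measure_pmf.variance ?P ?X / a\<^sup>2 \<le> (2 * real l)\<^sup>2 / real n / a\<^sup>2"
    by (rule divide_right_mono) simp
  moreover have "measure_pmf.prob ?P {f. a \<le> \<bar>?X f - measure_pmf.expectation ?P ?X\<bar>} \<le>
      measure_pmf.variance ?P ?X / a\<^sup>2"
    using measure_pmf.Chebyshev_inequality[of ?X ?P a] assms(2)
    by (simp add: integrable_random_recursive_tree)
  ultimately show ?thesis by (simp add: mult.commute)
qed

lemma protected_proportion_tendsto_in_prob:
  "tendsto_in_prob random_recursive_tree (protected_proportion l) (p_star l)"
  unfolding tendsto_in_prob_def
proof (intro allI impI)
  fix \<epsilon> :: real assume \<epsilon>: "0 < \<epsilon>"
  let ?m = "\<lambda>n. measure_pmf.expectation (random_recursive_tree n) (protected_proportion l n)"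
  \<comment> \<open>Half of \<epsilon> is spent on the distance of the mean from the limit, half on
    the fluctuation around the mean.\<close>
  have "\<forall>\<^sub>F n in sequentially. dist (?m n) (p_star l) < \<epsilon> / 2"
    using expectation_protected_proportion_tendsto \<epsilon> by (intro tendstoD) auto
  then have bound: "\<forall>\<^sub>F n in sequentially.
      measure_pmf.prob (random_recursive_tree n) {f. \<bar>protected_proportion l n f - p_star l\<bar> > \<epsilon>}
        \<le> (2 * real l)\<^sup>2 / (\<epsilon> / 2)\<^sup>2 / real n"
    using eventually_gt_at_top[of 0]
  proof eventually_elim
    case (elim n)
    have "{f. \<bar>protected_proportion l n f - p_star l\<bar> > \<epsilon>} \<subseteq>
      {f. \<epsilon> / 2 \<le> \<bar>protected_proportion l n f - ?m n\<bar>}"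
      using elim(1) unfolding dist_real_def by (intro Collect_mono impI) linarith
    then have "measure_pmf.prob (random_recursive_tree n) {f. \<bar>protected_proportion l n f - p_star l\<bar> > \<epsilon>} \<le>
      measure_pmf.prob (random_recursive_tree n) {f. \<epsilon> / 2 \<le> \<bar>protected_proportion l n f - ?m n\<bar>}"
      by (intro measure_pmf.finite_measure_mono) auto
    also have "\<dots> \<le> (2 * real l)\<^sup>2 / (\<epsilon> / 2)\<^sup>2 / real n"
      using elim \<epsilon> by (intro protected_proportion_deviation) auto
    finally show ?case .
  qed
  show "(\<lambda>n. measure_pmf.prob (random_recursive_tree n)
      {f. \<bar>protected_proportion l n f - p_star l\<bar> > \<epsilon>}) \<longlonglongrightarrow> 0"
    by (rule tendsto_sandwich[OF _ bound tendsto_const lim_const_over_n]) simp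
qed

lemma prob_random_tree_and_node:
  assumes "1 \<le> n"
  shows "measure_pmf.prob (random_tree_and_node n) {(f, v). l_protected l n f v} =
    measure_pmf.expectation (random_recursive_tree n) (protected_proportion l n)"
proof -
  let ?N = "pmf_of_set {1..n}" and ?B = "{(v, f). l_protected l n f v}"
  have fin: "finite (set_pmf ?N)" using assms by (simp add: set_pmf_of_set)
  \<comment> \<open>The pair is swapped because \<open>expectation_pair_pmf_finite\<close>
    integrates the first component innermost, and the node is to be averaged first.\<close>
  have "measure_pmf.prob (random_tree_and_node n) {(f, v). l_protected l n f v} =
      measure_pmf.prob (pair_pmf ?N (random_recursive_tree n)) ?B"
    unfolding random_tree_and_node_def pair_commute_pmf[of "random_recursive_tree n"]
    by (simp add: case_prod_unfold)
  also have "\<dots> = measure_pmf.expectation (pair_pmf ?N (random_recursive_tree n)) (indicator ?B)"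
    by simp
  also have "\<dots> = measure_pmf.expectation (random_recursive_tree n)
      (\<lambda>f. measure_pmf.expectation ?N (\<lambda>v. indicator ?B (v, f)))"
    by (intro expectation_pair_pmf_finite fin finite_set_random_recursive_tree)
  also have "(\<lambda>f. measure_pmf.expectation ?N (\<lambda>v. indicator ?B (v, f))) = protected_proportion l n"
  proof
    fix f
    have "measure_pmf.expectation ?N (\<lambda>v. indicator ?B (v, f)) =
        (\<Sum>v\<in>{1..n}. of_bool (l_protected l n f v)) / real n"
      using assms by (subst integral_pmf_of_set) (auto simp: indicator_def)
    also have "\<dots> = real (card ({1..n} \<inter> {v. l_protected l n f v})) / real n"
      by (subst sum_of_bool_eq) auto
    also have "{1..n} \<inter> {v. l_protected l n f v} = {v \<in> {1..n}. l_protected l n f v}" by blast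
    finally show "measure_pmf.expectation ?N (\<lambda>v. indicator ?B (v, f)) = protected_proportion l n f"
      unfolding protected_proportion_def .
  qed
  finally show ?thesis .
qed

theorem mainTheorem4:
  "(\<forall>l\<ge>1.
      (\<forall>n\<ge>1. measure_pmf.prob (random_tree_and_node n) {(f, v). l_protected l n f v}
           = measure_pmf.expectation (random_recursive_tree n) (protected_proportion l n))
    \<and> (\<lambda>n. measure_pmf.expectation (random_recursive_tree n) (protected_proportion l n))
         \<longlonglongrightarrow> p_star l
    \<and> tendsto_in_prob random_recursive_tree (protected_proportion l) (p_star l))
   \<and> (\<forall>t\<ge>0. p_fun 1 t = 1 - exp (- t))
   \<and> (\<forall>t\<ge>0. p_fun 2 t = exp (exp (- t) - 1) - exp (- t))
   \<and> p_star 2 = 1 / 2 - exp (- 1)"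
  using prob_random_tree_and_node expectation_protected_proportion_tendsto
    protected_proportion_tendsto_in_prob p_fun_1 p_fun_2 p_star_2
  by blast

end
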